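(* Let $V,\Lambda,\mu_s,w_s>0$ and put $\overline{C}_s=\frac{w_s}{\mu_s}+2\sqrt{\frac{w_s}{\Lambda\mu_s}}$. In the single-service model with standard service only (System S), the optimal policy of the service provider is characterized by the following effective arrival rate $\lambda_s^S$, lead time $W_s^S$ and optimal profit $\pi^S$: $$\lambda_s^S=\Lambda,\quad W_s^S=\sqrt{\tfrac{w_s}{\Lambda\mu_s}},\quad \pi^S=\Lambda(V-\overline{C}_s)\qquad\text{if } V\ge \overline{C}_s,$$ $$\lambda_s^S=0,\quad W_s^S=0,\quad \pi^S=0\qquad\text{otherwise.}$$
   Context: System S. Customers arrive at rate $\Lambda>0$. Each customer has a type $\theta$, uniform on $[0,1]$, and joins the service if and only if $U_s=V-p_s-\theta W_s\ge 0$, where $V>0$ is the service value, $p_s$ the price and $W_s$ the lead time. The service provider (SP) chooses the price $p_s$ and a (real) number $k_s\ge 0$ of employees, each with service rate $\mu_s>0$ and hourly wage $w_s>0$. The effective arrival rate $\lambda_s$ and lead time $W_s$ satisfy $$\lambda_s=\Lambda\Pr(U_s\ge 0),\qquad W_s=\frac{1}{k_s\mu_s-\lambda_s},\qquad k_s\mu_s>\lambda_s .$$ The SP maximizes $\pi(p_s,k_s)=p_s\lambda_s-w_sk_s$; the optimal value is $\pi^S$. The SP may also shut down the service, in which case $k_s=0$, $\lambda_s=0$, the profit is $0$, and $W_s=0$ by convention. *)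

theory Defs
  imports "HOL-Probability.Probability"
begin

definition join_prob :: "real \<Rightarrow> real \<Rightarrow> real \<Rightarrow> real" where
  "join_prob V p W = measure (uniform_measure lborel {0..1}) {\<theta>. V - p - \<theta> * W \<ge> 0}"

datatype policy =
    Operate (price: real) (employees: real)
  | Shutdown

text \<open>The arrival rate and the lead time determine each other, so the outcome of a policy is
  a relation: \<open>induces V \<Lambda> \<mu> P l W\<close> says that \<open>(l, W)\<close> is an equilibrium under \<open>P\<close>. Since
  \<open>l \<ge> 0\<close>, the stability constraint already excludes operating with no employees.\<close>

primrec induces :: "real \<Rightarrow> real \<Rightarrow> real \<Rightarrow> policy \<Rightarrow> real \<Rightarrow> real \<Rightarrow> bool" where
  "induces V \<Lambda> \<mu> (Operate p k) l W \<longleftrightarrow>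
     k \<ge> 0 \<and> k * \<mu> > l \<and> l = \<Lambda> * join_prob V p W \<and> W = 1 / (k * \<mu> - l)"
| "induces V \<Lambda> \<mu> Shutdown l W \<longleftrightarrow> l = 0 \<and> W = 0"

primrec profit :: "real \<Rightarrow> policy \<Rightarrow> real \<Rightarrow> real" where
  "profit w (Operate p k) l = p * l - w * k"
| "profit w Shutdown l = 0"

definition optimal :: "real \<Rightarrow> real \<Rightarrow> real \<Rightarrow> real \<Rightarrow> policy \<Rightarrow> real \<Rightarrow> real \<Rightarrow> bool" where
  "optimal V \<Lambda> \<mu> w P l W \<longleftrightarrow>
     induces V \<Lambda> \<mu> P l W \<and>
     (\<forall>P' l' W'. induces V \<Lambda> \<mu> P' l' W' \<longrightarrow> profit w P' l' \<le> profit w P l)"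

definition optimal_outcomes :: "real \<Rightarrow> real \<Rightarrow> real \<Rightarrow> real \<Rightarrow> (real \<times> real) set" where
  "optimal_outcomes V \<Lambda> \<mu> w = {(l, W). \<exists>P. optimal V \<Lambda> \<mu> w P l W}"

text \<open>A supremum over the reals is only meaningful when the set is bounded above; it is the
  maximal profit whenever \<open>optimal_outcomes\<close> is nonempty.\<close>

definition optimal_profit :: "real \<Rightarrow> real \<Rightarrow> real \<Rightarrow> real \<Rightarrow> real" where
  "optimal_profit V \<Lambda> \<mu> w = Sup {profit w P l | P l W. induces V \<Lambda> \<mu> P l W}"

definition C_bar :: "real \<Rightarrow> real \<Rightarrow> real \<Rightarrow> real" where
  "C_bar \<Lambda> \<mu> w = w / \<mu> + 2 * sqrt (w / (\<Lambda> * \<mu>))"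

end

theory Submission
  imports Defs
begin

text \<open>When \<open>l > 0\<close>, the marginal type is at least \<open>l / \<Lambda>\<close>, so \<open>p \<le> V - (l / \<Lambda>) * W\<close>, and the lead time
  equation gives \<open>k = (l + 1 / W) / \<mu>\<close>. Completing the square in \<open>W\<close> bounds the profit by
  \<open>l * (V - C_bar \<Lambda> \<mu> w)\<close> minus a square that vanishes, for \<open>l = \<Lambda>\<close>, exactly at
  \<open>W = sqrt (w / (\<Lambda> * \<mu>))\<close>. This bound is linear in \<open>l\<close>, so only the sign of
  \<open>V - C_bar \<Lambda> \<mu> w\<close> matters.\<close>

lemma join_prob_eq:
  "join_prob V p W = measure lborel ({0..1} \<inter> {\<theta>. V - p - \<theta> * W \<ge> 0})"
  by (simp add: join_prob_def measure_uniform_measure)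

lemma join_prob_nonneg: "0 \<le> join_prob V p W"
  by (simp add: join_prob_def)

lemma join_prob_le_1: "join_prob V p W \<le> 1"
proof -
  have "join_prob V p W \<le> measure lborel {0..1::real}"
    unfolding join_prob_eq by (intro measure_mono_fmeasurable) (auto simp: fmeasurable_def)
  then show ?thesis by simp
qed

lemma join_prob_eq_1:
  assumes "0 \<le> W" "p \<le> V - W"
  shows "join_prob V p W = 1"
proof -
  have "\<theta> * W \<le> V - p" if "\<theta> \<le> 1" for \<theta>
    using mult_right_mono[OF that assms(1)] assms(2) by linarith
  then have "{0..1} \<inter> {\<theta>. V - p - \<theta> * W \<ge> 0} = {0..1}"
    by force
  then show ?thesis by (simp add: join_prob_eq)
qed

text \<open>The joining types form an initial segment of \<open>{0..1}\<close> cut off at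
  \<open>(V - p) / W\<close>, so their measure is at most that endpoint. Positivity of the
  probability excludes \<open>p > V\<close>, where nobody joins and the inequality fails.\<close>

lemma join_prob_mult_le:
  assumes "0 < W" "0 < join_prob V p W"
  shows "join_prob V p W * W \<le> V - p"
proof -
  have "join_prob V p W \<le> measure lborel {0..(V - p) / W}"
    unfolding join_prob_eq
    by (intro measure_mono_fmeasurable) (use assms(1) in \<open>auto simp: field_simps fmeasurable_def emeasure_lborel_Icc_eq\<close>)
  \<comment> \<open>The interval is empty when \<open>p > V\<close>, so its length is truncated at
    0.\<close>
  also have "\<dots> = max 0 ((V - p) / W)"
    by (simp add: max_def)
  finally have "join_prob V p W \<le> (V - p) / W"
    using assms(2) by linarith
  then show ?thesis
    using assms(1) by (simp add: field_simps)
qed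

lemma induces_OperateD:
  assumes "induces V \<Lambda> \<mu> (Operate p k) l W"
  shows "0 \<le> k" "l < k * \<mu>" "l = \<Lambda> * join_prob V p W" "W = 1 / (k * \<mu> - l)"
  using assms unfolding induces.simps by blast+

lemma operate_rate_bounds:
  assumes "\<Lambda> > 0" "induces V \<Lambda> \<mu> (Operate p k) l W"
  shows "0 \<le> l" "l \<le> \<Lambda>" "0 < W"
proof -
  note eq = induces_OperateD[OF assms(2)]
  show "0 \<le> l" "l \<le> \<Lambda>"
    unfolding eq(3) using assms(1) join_prob_nonneg join_prob_le_1
    by (simp_all add: mult_left_le)
  show "0 < W"
    unfolding eq(4) using eq(2) by simp
qed

lemma operate_profit_le:
  assumes "\<Lambda> > 0" "\<mu> > 0" "w > 0"
    and ind: "induces V \<Lambda> \<mu> (Operate p k) l W"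
  shows "profit w (Operate p k) l
    \<le> l * (V - C_bar \<Lambda> \<mu> w) - (l * W - \<Lambda> * sqrt (w / (\<Lambda> * \<mu>)))\<^sup>2 / (\<Lambda> * W)"
proof -
  define s where "s = sqrt (w / (\<Lambda> * \<mu>))"
  have s2: "s * s = w / (\<Lambda> * \<mu>)"
    using assms(1-3) by (simp add: s_def)
  have W: "W > 0" and l: "0 \<le> l" "l = \<Lambda> * join_prob V p W"
    using operate_rate_bounds[OF assms(1) ind] induces_OperateD(3)[OF ind] by blast+
  have "k * \<mu> - l = 1 / W"
    unfolding induces_OperateD(4)[OF ind] by simp
  then have k: "k = (l + 1 / W) / \<mu>"
    using assms(2) by (simp add: field_simps)
  \<comment> \<open>Multiplying by \<open>l\<close> absorbs the case where nobody joins, in which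
    the price has no upper bound.\<close>
  have "p * l \<le> (V - l / \<Lambda> * W) * l"
  proof (cases "l = 0")
    case False
    then have "join_prob V p W > 0"
      using l(2) assms(1) join_prob_nonneg[of V p W] by simp
    then have "p \<le> V - l / \<Lambda> * W"
      using join_prob_mult_le[OF W, of V p] l(2) assms(1) by simp
    then show ?thesis using l(1) by (rule mult_right_mono)
  qed simp
  then have "profit w (Operate p k) l \<le> (V - l / \<Lambda> * W) * l - w * ((l + 1 / W) / \<mu>)"
    by (simp add: k)
  \<comment> \<open>Adding and subtracting \<open>2 * l * s\<close> completes the linear part and
    supplies the cross term of the square over \<open>\<Lambda> * W\<close>.\<close>
  also have "\<dots> = l * (V - (w / \<mu> + 2 * s))
      - (l * l * W / \<Lambda> - 2 * l * s + \<Lambda> * (w / (\<Lambda> * \<mu>)) / W)"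
    using assms(1-3) W by (simp add: field_simps)
  also have "l * l * W / \<Lambda> - 2 * l * s + \<Lambda> * (w / (\<Lambda> * \<mu>)) / W = (l * W - \<Lambda> * s)\<^sup>2 / (\<Lambda> * W)"
    unfolding s2[symmetric] using assms(1) W by (simp add: field_simps power2_eq_square)
  finally show ?thesis
    by (simp add: C_bar_def s_def)
qed

text \<open>Stability forces a positive staff even without customers, so wages are paid and no
  revenue comes in.\<close>

lemma operate_profit_neg:
  assumes "\<mu> > 0" "w > 0" "induces V \<Lambda> \<mu> (Operate p k) 0 W"
  shows "profit w (Operate p k) 0 < 0"
proof -
  have "0 < k"
    using induces_OperateD(2)[OF assms(3)] assms(1) by (simp add: zero_less_mult_iff)
  then show ?thesis using assms(2) by simp
qed

text \<open>The price \<open>V - s\<close> leaves type 1 just indifferent at lead time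
  \<open>s\<close>, so everyone joins; the staffing leaves exactly \<open>1 / s\<close> of spare
  capacity, which reproduces that lead time.\<close>

lemma full_coverage_policy:
  fixes V \<Lambda> \<mu> w :: real
  assumes "\<Lambda> > 0" "\<mu> > 0" "w > 0"
  defines "s \<equiv> sqrt (w / (\<Lambda> * \<mu>))"
  defines "P \<equiv> Operate (V - s) ((\<Lambda> + 1 / s) / \<mu>)"
  shows "induces V \<Lambda> \<mu> P \<Lambda> s" "profit w P \<Lambda> = \<Lambda> * (V - C_bar \<Lambda> \<mu> w)"
proof -
  have s: "s > 0" and s2: "s * s = w / (\<Lambda> * \<mu>)"
    using assms by (simp_all add: s_def)
  show "induces V \<Lambda> \<mu> P \<Lambda> s"
    using assms(1,2) s by (simp add: P_def join_prob_eq_1)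
  have "w / \<mu> = \<Lambda> * (s * s)"
    using assms(1,2) by (simp add: s2)
  \<comment> \<open>The wages for the spare capacity equal the total price concession
    \<open>\<Lambda> * s\<close>; hence the factor 2 in \<open>C_bar\<close>.\<close>
  then have "w / \<mu> / s = \<Lambda> * s"
    using s by simp
  moreover have "w * ((\<Lambda> + 1 / s) / \<mu>) = \<Lambda> * (w / \<mu>) + w / \<mu> / s"
    using assms(2) s by (simp add: field_simps)
  ultimately show "profit w P \<Lambda> = \<Lambda> * (V - C_bar \<Lambda> \<mu> w)"
    by (simp add: P_def C_bar_def flip: s_def) (simp add: algebra_simps)
qed

text \<open>An optimal profit lies in the set of profits and bounds it above, so the supremum is a
  maximum.\<close>

lemma optimal_profit_eq:
  assumes "optimal V \<Lambda> \<mu> w P l W"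
  shows "optimal_profit V \<Lambda> \<mu> w = profit w P l"
  unfolding optimal_profit_def
  by (rule cSup_eq_maximum) (use assms in \<open>auto simp: optimal_def\<close>)

text \<open>Dropping the square leaves a bound that also covers \<open>Shutdown\<close>, where both
  sides are 0.\<close>

lemma profit_le:
  assumes "\<Lambda> > 0" "\<mu> > 0" "w > 0" "induces V \<Lambda> \<mu> P l W"
  shows "profit w P l \<le> l * (V - C_bar \<Lambda> \<mu> w)" "0 \<le> l" "l \<le> \<Lambda>"
proof (atomize (full), cases P)
  case (Operate p k)
  have "0 \<le> (l * W - \<Lambda> * sqrt (w / (\<Lambda> * \<mu>)))\<^sup>2 / (\<Lambda> * W)"
    using operate_rate_bounds(3)[OF assms(1) assms(4)[unfolded Operate]] assms(1) by simp
  then show "profit w P l \<le> l * (V - C_bar \<Lambda> \<mu> w) \<and> 0 \<le> l \<and> l \<le> \<Lambda>"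
    using operate_profit_le[OF assms(1-3) assms(4)[unfolded Operate]]
      operate_rate_bounds[OF assms(1) assms(4)[unfolded Operate]]
    unfolding Operate by linarith
qed (use assms in auto)

text \<open>With a nonnegative slope, the linear bound is largest at \<open>l = \<Lambda>\<close>,
  and the full coverage policy attains it there.\<close>

lemma full_coverage_optimal:
  fixes V \<Lambda> \<mu> w :: real
  assumes "\<Lambda> > 0" "\<mu> > 0" "w > 0" "V \<ge> C_bar \<Lambda> \<mu> w"
  obtains P where "optimal V \<Lambda> \<mu> w P \<Lambda> (sqrt (w / (\<Lambda> * \<mu>)))"
    and "profit w P \<Lambda> = \<Lambda> * (V - C_bar \<Lambda> \<mu> w)"
proof
  let ?s = "sqrt (w / (\<Lambda> * \<mu>))"
  let ?P = "Operate (V - ?s) ((\<Lambda> + 1 / ?s) / \<mu>)"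
  note full = full_coverage_policy[OF assms(1-3)]
  show "profit w ?P \<Lambda> = \<Lambda> * (V - C_bar \<Lambda> \<mu> w)"
    by (rule full)
  have "profit w P' l' \<le> profit w ?P \<Lambda>" if "induces V \<Lambda> \<mu> P' l' W'" for P' l' W'
  proof -
    note b = profit_le[OF assms(1-3) that]
    have "l' * (V - C_bar \<Lambda> \<mu> w) \<le> \<Lambda> * (V - C_bar \<Lambda> \<mu> w)"
      using b assms(4) by (intro mult_right_mono) auto
    then show ?thesis
      using b(1) full(2)[of V] by linarith
  qed
  then show "optimal V \<Lambda> \<mu> w ?P \<Lambda> ?s"
    unfolding optimal_def using full(1)[of V] by blast
qed

text \<open>An optimal policy serving everyone must attain the bound, so the subtracted square is 0,
  which determines \<open>W\<close>.\<close>

lemma optimal_full_coverage_lead_time: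
  assumes "\<Lambda> > 0" "\<mu> > 0" "w > 0" "V \<ge> C_bar \<Lambda> \<mu> w" "optimal V \<Lambda> \<mu> w P \<Lambda> W"
  shows "W = sqrt (w / (\<Lambda> * \<mu>))"
proof -
  let ?s = "sqrt (w / (\<Lambda> * \<mu>))"
  have ind: "induces V \<Lambda> \<mu> P \<Lambda> W"
    using assms(5) by (simp add: optimal_def)
  \<comment> \<open>\<open>Shutdown\<close> induces rate 0, which differs from
    \<open>\<Lambda>\<close>.\<close>
  then obtain p k where P: "P = Operate p k"
    using assms(1) by (metis induces.simps(2) less_irrefl policy.exhaust)
  have W: "W > 0"
    using operate_rate_bounds(3)[OF assms(1)] ind P by blast
  have "\<Lambda> * (V - C_bar \<Lambda> \<mu> w) \<le> profit w P \<Lambda>"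
    using full_coverage_policy[OF assms(1-3), of V] assms(5)
    unfolding optimal_def by metis
  then have "(\<Lambda> * W - \<Lambda> * ?s)\<^sup>2 / (\<Lambda> * W) \<le> 0"
    using operate_profit_le[OF assms(1-3) ind[unfolded P]] P by simp
  moreover have "\<Lambda> * W > 0"
    using assms(1) W by simp
  ultimately have "(\<Lambda> * W - \<Lambda> * ?s)\<^sup>2 \<le> 0"
    by (metis divide_pos_pos not_le)
  then show ?thesis
    using assms(1) by simp
qed

text \<open>A strictly positive slope makes every rate below \<open>\<Lambda>\<close> fall short of
  the full coverage profit.\<close>

lemma optimal_rate_full:
  assumes "\<Lambda> > 0" "\<mu> > 0" "w > 0" "V > C_bar \<Lambda> \<mu> w" "optimal V \<Lambda> \<mu> w P l W"
  shows "l = \<Lambda>"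
proof -
  have ind: "induces V \<Lambda> \<mu> P l W"
    using assms(5) by (simp add: optimal_def)
  have "\<Lambda> * (V - C_bar \<Lambda> \<mu> w) \<le> profit w P l"
    using full_coverage_policy[OF assms(1-3), of V] assms(5)
    unfolding optimal_def by metis
  also have "\<dots> \<le> l * (V - C_bar \<Lambda> \<mu> w)"
    using profit_le(1)[OF assms(1-3) ind] .
  finally have "\<Lambda> \<le> l"
    using assms(4) by simp
  then show ?thesis
    using profit_le(3)[OF assms(1-3) ind] by simp
qed

text \<open>For \<open>l > 0\<close> the negative slope gives strictness; at \<open>l = 0\<close>
  the linear bound is only 0, and the wage cost gives it instead.\<close>

lemma operate_unprofitable:
  assumes "\<Lambda> > 0" "\<mu> > 0" "w > 0" "V < C_bar \<Lambda> \<mu> w"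
    and ind: "induces V \<Lambda> \<mu> (Operate p k) l W"
  shows "profit w (Operate p k) l < 0"
proof (cases "l = 0")
  case True
  then show ?thesis
    using operate_profit_neg[OF assms(2,3)] ind by blast
next
  case False
  then have "l * (V - C_bar \<Lambda> \<mu> w) < 0"
    using profit_le(2)[OF assms(1-3) ind] assms(4) by (intro mult_pos_neg) auto
  then show ?thesis
    using profit_le(1)[OF assms(1-3) ind] by linarith
qed

lemma optimal_iff_shutdown:
  assumes "\<Lambda> > 0" "\<mu> > 0" "w > 0" "V < C_bar \<Lambda> \<mu> w"
  shows "optimal V \<Lambda> \<mu> w P l W \<longleftrightarrow> P = Shutdown \<and> l = 0 \<and> W = 0"
proof
  assume opt: "optimal V \<Lambda> \<mu> w P l W"
  have "induces V \<Lambda> \<mu> Shutdown 0 0" by simp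
  then have "profit w Shutdown 0 \<le> profit w P l"
    using opt unfolding optimal_def by blast
  then have "0 \<le> profit w P l"
    by simp
  then show "P = Shutdown \<and> l = 0 \<and> W = 0"
    using operate_unprofitable[OF assms] opt unfolding optimal_def
    by (metis induces.simps(2) not_le policy.exhaust)
next
  have "profit w P' l' \<le> 0" if "induces V \<Lambda> \<mu> P' l' W'" for P' l' W'
    using operate_unprofitable[OF assms] that
    by (metis less_imp_le order_refl policy.exhaust profit.simps(2))
  then show "optimal V \<Lambda> \<mu> w P l W" if "P = Shutdown \<and> l = 0 \<and> W = 0"
    using that by (auto simp: optimal_def)
qed

text \<open>At \<open>V = C_bar \<Lambda> \<mu> w\<close> the optimal profit is 0, so
  \<open>Shutdown\<close> is optimal too. Uniqueness of the whole outcome is therefore claimed only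
  off this threshold; on it, only the lead time belonging to rate \<open>\<Lambda>\<close> is
  determined.\<close>

theorem proposition1:
  fixes V \<Lambda> \<mu> w :: real
  assumes "V > 0" and "\<Lambda> > 0" and "\<mu> > 0" and "w > 0"
  shows "(V \<ge> C_bar \<Lambda> \<mu> w \<longrightarrow>
            (\<forall>W. (\<Lambda>, W) \<in> optimal_outcomes V \<Lambda> \<mu> w \<longleftrightarrow> W = sqrt (w / (\<Lambda> * \<mu>))) \<and>
            optimal_profit V \<Lambda> \<mu> w = \<Lambda> * (V - C_bar \<Lambda> \<mu> w)) \<and>
         (V > C_bar \<Lambda> \<mu> w \<longrightarrow>
            optimal_outcomes V \<Lambda> \<mu> w = {(\<Lambda>, sqrt (w / (\<Lambda> * \<mu>)))}) \<and>
         (V < C_bar \<Lambda> \<mu> w \<longrightarrow>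
            optimal_outcomes V \<Lambda> \<mu> w = {(0, 0)} \<and>
            optimal_profit V \<Lambda> \<mu> w = 0)"
proof (intro conjI impI)
  note pos = assms(2-4)
  let ?s = "sqrt (w / (\<Lambda> * \<mu>))"
  have outcomes: "(\<Lambda>, W) \<in> optimal_outcomes V \<Lambda> \<mu> w \<longleftrightarrow> W = ?s"
    if V: "V \<ge> C_bar \<Lambda> \<mu> w" for W
    unfolding optimal_outcomes_def mem_Collect_eq case_prod_conv
    using full_coverage_optimal[OF pos V] optimal_full_coverage_lead_time[OF pos V] by metis
  then show "\<forall>W. (\<Lambda>, W) \<in> optimal_outcomes V \<Lambda> \<mu> w \<longleftrightarrow> W = ?s"
    if "V \<ge> C_bar \<Lambda> \<mu> w"
    using that by blast
  show "optimal_profit V \<Lambda> \<mu> w = \<Lambda> * (V - C_bar \<Lambda> \<mu> w)" if "V \<ge> C_bar \<Lambda> \<mu> w"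
    using full_coverage_optimal[OF pos that] optimal_profit_eq by metis
  show "optimal_outcomes V \<Lambda> \<mu> w = {(\<Lambda>, ?s)}" if V: "V > C_bar \<Lambda> \<mu> w"
  proof -
    have "l = \<Lambda>" if "(l, W) \<in> optimal_outcomes V \<Lambda> \<mu> w" for l W
      using that optimal_rate_full[OF pos V]
      unfolding optimal_outcomes_def mem_Collect_eq case_prod_conv by blast
    moreover have "(\<Lambda>, W) \<in> optimal_outcomes V \<Lambda> \<mu> w \<longleftrightarrow> W = ?s" for W
      using outcomes V by simp
    ultimately show ?thesis
      by (intro set_eqI) (metis prod.collapse singleton_iff)
  qed
  assume V: "V < C_bar \<Lambda> \<mu> w"
  note iff = optimal_iff_shutdown[OF pos V]
  show "optimal_outcomes V \<Lambda> \<mu> w = {(0, 0)}"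
    by (auto simp: optimal_outcomes_def iff)
  have "optimal V \<Lambda> \<mu> w Shutdown 0 0"
    by (simp add: iff)
  then show "optimal_profit V \<Lambda> \<mu> w = 0"
    using optimal_profit_eq by fastforce
qed

end
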